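(* For every integer $n\geq 1$: \begin{enumerate} \item $|\mathrm{flat}_1(\mathcal{Q}_n)|=1$, and \item $|\mathrm{flat}_2(\mathcal{Q}_{n+1})|=2\,|\mathrm{flat}_2(\mathcal{Q}_n)|+2n-1$, with $|\mathrm{flat}_2(\mathcal{Q}_1)|=0$. \end{enumerate}
   Context: A Stirling permutation of order $n$ is a word $w=w_1w_2\cdots w_{2n}$ in which every letter of $\{1,\dots,n\}$ appears exactly twice and such that, for each $i$, every letter appearing between the two occurrences of $i$ is greater than $i$. $\mathcal{Q}_n$ is the set of Stirling permutations of order $n$. The runs of $w\in\mathcal{Q}_n$ are its maximal contiguous weakly increasing subwords. $w$ is flattened if the sequence of leading (first) terms of its runs, read from left to right, is weakly increasing. $\mathrm{flat}_k(\mathcal{Q}_n)$ is the set of flattened elements of $\mathcal{Q}_n$ having exactly $k$ runs. *)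

theory Defs
  imports Main
begin

definition stirling_perms :: "nat \<Rightarrow> nat list set" where
  "stirling_perms n =
     {w. length w = 2 * n \<and> set w \<subseteq> {1..n} \<and>
         (\<forall>i\<in>{1..n}. count_list w i = 2) \<and>
         (\<forall>a b c. a < b \<and> b < c \<and> c < length w \<and> w ! a = w ! c \<longrightarrow> w ! a < w ! b)}"

definition subword :: "nat list \<Rightarrow> nat \<Rightarrow> nat \<Rightarrow> nat list" where
  "subword w i j = take (j - i) (drop i w)"

text \<open>
  A run is represented by the pair \<open>(i, j)\<close> delimiting the half-open interval \<open>i..<j\<close> of positions
  (counted from 0) that it occupies, so that runs are counted by occurrence in the word.
\<close>

definition runs :: "nat list \<Rightarrow> (nat \<times> nat) set" where
  "runs w =
     {(i, j). i < j \<and> j \<le> length w \<and> sorted (subword w i j) \<and>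
        (\<forall>i' j'. i' \<le> i \<and> j \<le> j' \<and> j' \<le> length w \<and> sorted (subword w i' j')
           \<longrightarrow> i' = i \<and> j' = j)}"

definition flattened :: "nat list \<Rightarrow> bool" where
  "flattened w \<longleftrightarrow>
     (\<forall>(i, j)\<in>runs w. \<forall>(i', j')\<in>runs w. i \<le> i' \<longrightarrow> w ! i \<le> w ! i')"

definition flat :: "nat \<Rightarrow> nat list set \<Rightarrow> nat list set" where
  "flat k Q = {w \<in> Q. flattened w \<and> card (runs w) = k}"

lemma finite_runs: "finite (runs w)"
  by (rule finite_subset[of _ "{..length w} \<times> {..length w}"]) (auto simp: runs_def)

lemma finite_stirling_perms: "finite (stirling_perms n)"
  by (rule finite_subset[OF _ finite_lists_length_eq[of "{1..n}" "2 * n"]])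
     (auto simp: stirling_perms_def)

end

theory Submission
  imports Defs
begin

text \<open>
  A run other than the first one begins exactly at a descent bottom, so a nonempty word has one more
  run than it has descents. A flattened Stirling permutation must begin with the letter 1, because
  the first 1 in the word always begins a run. Conversely, a Stirling permutation that begins with 1
  and has at most two runs is flattened, since only one comparison, with the leading 1, is to be
  made. For \<open>k = 1\<close> and \<open>k = 2\<close> the sets to be counted therefore consist of the Stirling permutations that begin
  with 1 and have \<open>k - 1\<close> descents (\<open>flat_eq_one_headed\<close>).

  The two copies of the greatest letter \<open>n + 1\<close> are adjacent, because nothing greater can separate
  them. So each Stirling permutation of order \<open>n + 1\<close> arises exactly once by inserting the block
  \<open>(n + 1)(n + 1)\<close> into one of the \<open>2n + 1\<close> gaps of one of order \<open>n\<close> (\<open>bij_betw_insert_pair\<close>). For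
  \<open>n \<ge> 1\<close> the new word begins with 1 iff the old one does and the gap is not the leftmost one. At the
  right end, or inside a descent, the block leaves the number of descents unchanged; in every other
  gap it creates one new descent (\<open>card_descents_insert_pair\<close>). Without the leftmost gap, a word with
  \<open>d\<close> descents thus has \<open>d + 1\<close> gaps that preserve \<open>d\<close>, and \<open>2n - 1 - d\<close> that raise it to \<open>d + 1\<close>. This is a recurrence of
  Eulerian type for the number of words with \<open>d\<close> descents (\<open>card_one_headed_0\<close> and
  \<open>card_one_headed_Suc\<close>); its cases \<open>d = 0\<close> and \<open>d = 1\<close> give the claim.
\<close>

section \<open>Runs and descents\<close>

text \<open>Descents are recorded by their bottoms, so that they are the leading positions of all runs but
  the first.\<close>

definition descents :: "nat list \<Rightarrow> nat set" where
  "descents w = {k. 0 < k \<and> k < length w \<and> w ! k < w ! (k - 1)}"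

lemma finite_descents [simp]: "finite (descents w)"
  by (rule finite_subset[of _ "{..<length w}"]) (auto simp: descents_def)

lemma sorted_subword_iff:
  assumes "j \<le> length w"
  shows "sorted (subword w i j) \<longleftrightarrow> (\<forall>k. i < k \<and> k < j \<longrightarrow> w ! (k - 1) \<le> w ! k)"
proof -
  have len: "length (subword w i j) = j - i"
    using assms by (simp add: subword_def)
  have nth: "subword w i j ! m = w ! (i + m)" if "m < j - i" for m
    using assms that by (simp add: subword_def)
  have "sorted (subword w i j) \<longleftrightarrow> (\<forall>m. Suc m < j - i \<longrightarrow> w ! (i + m) \<le> w ! (i + Suc m))"
    by (auto simp: sorted_iff_nth_Suc len nth)
  also have "\<dots> \<longleftrightarrow> (\<forall>k. i < k \<and> k < j \<longrightarrow> w ! (k - 1) \<le> w ! k)" (is "?L \<longleftrightarrow> ?R")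
  proof
    assume L: ?L
    show ?R
    proof (intro allI impI)
      fix k assume k: "i < k \<and> k < j"
      then obtain m where "k = Suc (i + m)"
        by (auto simp: less_iff_Suc_add)
      then show "w ! (k - 1) \<le> w ! k"
        using L[rule_format, of m] k by simp
    qed
  next
    assume R: ?R
    show ?L
    proof (intro allI impI)
      fix m assume "Suc m < j - i"
      then show "w ! (i + m) \<le> w ! (i + Suc m)"
        using R[rule_format, of "i + Suc m"] by simp
    qed
  qed
  finally show ?thesis .
qed

lemma inj_on_fst_runs: "inj_on fst (runs w)"
proof (rule inj_onI)
  fix r s assume rs: "r \<in> runs w" "s \<in> runs w" "fst r = fst s"
  have longest: "j' = j" if "(i, j) \<in> runs w" "(i, j') \<in> runs w" "j \<le> j'" for i j j'
    using that unfolding runs_def by blast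
  obtain i j j' where "r = (i, j)" "s = (i, j')"
    using rs(3) by (cases r; cases s) auto
  then show "r = s"
    using rs(1,2) longest[of i j j'] longest[of i j' j] by (cases "j \<le> j'") auto
qed

lemma fst_image_runs:
  assumes "w \<noteq> []"
  shows "fst ` runs w = insert 0 (descents w)"
proof (intro equalityI subsetI)
  fix i assume "i \<in> fst ` runs w"
  then obtain j where ij: "i < j" "j \<le> length w" "sorted (subword w i j)"
    and max: "\<And>i' j'. i' \<le> i \<Longrightarrow> j \<le> j' \<Longrightarrow> j' \<le> length w \<Longrightarrow> sorted (subword w i' j') \<Longrightarrow> i' = i \<and> j' = j"
    by (auto simp: runs_def)
  show "i \<in> insert 0 (descents w)"
  proof (rule ccontr)
    assume "i \<notin> insert 0 (descents w)"
    then have i: "0 < i" "w ! (i - 1) \<le> w ! i"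
      using ij by (auto simp: descents_def)
    have "w ! (k - 1) \<le> w ! k" if "i - 1 < k" "k < j" for k
    proof (cases "k = i")
      case False
      then show ?thesis
        using that ij by (auto simp: sorted_subword_iff)
    qed (use i in simp)
    then have "sorted (subword w (i - 1) j)"
      using ij by (simp add: sorted_subword_iff)
    then show False
      using max[of "i - 1" j] ij i by simp
  qed
next
  fix i assume i: "i \<in> insert 0 (descents w)"
  \<comment> \<open>The run that begins at \<open>i\<close> is the longest sorted interval with left end \<open>i\<close>; a sorted interval
    cannot extend to the left of \<open>i\<close>, as it would then contain the descent at \<open>i\<close>.\<close>
  define J where "J = {j. i < j \<and> j \<le> length w \<and> sorted (subword w i j)}"
  have "finite J"
    by (rule finite_subset[of _ "{..length w}"]) (auto simp: J_def)
  moreover have "Suc i \<in> J"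
    using i assms by (auto simp: J_def sorted_subword_iff descents_def Suc_le_eq)
  ultimately have Max: "Max J \<in> J" "\<And>j. j \<in> J \<Longrightarrow> j \<le> Max J"
    using Max_in[of J] Max_ge[of J] by blast+
  have "(i, Max J) \<in> runs w"
    unfolding runs_def mem_Collect_eq case_prod_conv
  proof (intro conjI allI impI)
    fix i' j' assume *: "i' \<le> i \<and> Max J \<le> j' \<and> j' \<le> length w \<and> sorted (subword w i' j')"
    have lt: "i < Max J"
      using Max(1) by (auto simp: J_def)
    show "i' = i"
    proof (rule ccontr)
      assume "i' \<noteq> i"
      then have "w ! (i - 1) \<le> w ! i"
        using * lt by (auto simp: sorted_subword_iff)
      then show False
        using i * \<open>i' \<noteq> i\<close> by (auto simp: descents_def)
    qed
    then have "j' \<in> J"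
      using * lt by (auto simp: J_def)
    then show "j' = Max J"
      using Max(2) * by (simp add: le_antisym)
  qed (use Max(1) in \<open>auto simp: J_def\<close>)
  then show "i \<in> fst ` runs w"
    by (force intro: rev_image_eqI)
qed

lemma card_runs:
  assumes "w \<noteq> []"
  shows "card (runs w) = Suc (card (descents w))"
proof -
  have "card (runs w) = card (insert 0 (descents w))"
    by (metis card_image inj_on_fst_runs fst_image_runs[OF assms])
  also have "\<dots> = Suc (card (descents w))"
    by (subst card_insert_disjoint) (auto simp: descents_def)
  finally show ?thesis .
qed

lemma flattened_iff:
  assumes "w \<noteq> []"
  shows "flattened w \<longleftrightarrow>
    (\<forall>i\<in>insert 0 (descents w). \<forall>i'\<in>insert 0 (descents w). i \<le> i' \<longrightarrow> w ! i \<le> w ! i')"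
  unfolding fst_image_runs[OF assms, symmetric] flattened_def by fastforce

lemma card_descents_append:
  "card (descents (u @ v)) =
     card (descents u) + card (descents v) + of_bool (u \<noteq> [] \<and> v \<noteq> [] \<and> hd v < last u)"
proof -
  let ?B = "if u \<noteq> [] \<and> v \<noteq> [] \<and> hd v < last u then {length u} else {}"
  have "k \<in> descents (u @ v) \<longleftrightarrow> k \<in> descents u \<union> (+) (length u) ` descents v \<union> ?B" for k
  proof (cases k "length u" rule: linorder_cases)
    case less
    then show ?thesis
      by (auto simp: descents_def nth_append)
  next
    case equal
    then show ?thesis
      by (auto simp: descents_def nth_append hd_conv_nth last_conv_nth)
  next
    case greater
    then obtain m where m: "k = length u + m" "0 < m"
      by (metis less_imp_add_positive)
    then show ?thesis
      by (auto simp: descents_def nth_append)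
  qed
  then have "descents (u @ v) = (descents u \<union> (+) (length u) ` descents v) \<union> ?B"
    by blast
  moreover have "card (descents u \<union> (+) (length u) ` descents v) = card (descents u) + card (descents v)"
    by (subst card_Un_disjoint) (auto simp: card_image descents_def)
  moreover have "(descents u \<union> (+) (length u) ` descents v) \<inter> ?B = {}"
    by (auto simp: descents_def)
  ultimately show ?thesis
    by (subst \<open>descents (u @ v) = _\<close>, subst card_Un_disjoint) auto
qed

section \<open>Flattened words with at most two runs\<close>

definition one_headed :: "nat \<Rightarrow> nat \<Rightarrow> nat list set" where
  "one_headed n d = {w \<in> stirling_perms n. hd w = 1 \<and> card (descents w) = d}"

lemma set_stirling_perm:
  assumes "w \<in> stirling_perms n"
  shows "set w = {1..n}"
proof
  show "set w \<subseteq> {1..n}"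
    using assms by (simp add: stirling_perms_def)
  show "{1..n} \<subseteq> set w"
  proof
    fix i assume "i \<in> {1..n}"
    then have "count_list w i \<noteq> 0"
      using assms by (simp add: stirling_perms_def)
    then show "i \<in> set w"
      by (metis count_list_0_iff)
  qed
qed

text \<open>The first 1 in the word is preceded by nothing or by a greater letter, so it begins a run;
  the leading letter of the first run can then be no greater.\<close>

lemma hd_flattened:
  assumes "w \<in> stirling_perms n" "n \<ge> 1" "flattened w"
  shows "hd w = 1"
proof -
  have set: "set w = {1..n}"
    by (rule set_stirling_perm[OF assms(1)])
  then have ne: "w \<noteq> []" and "1 \<in> set w"
    using assms(2) by auto
  then obtain u v where w: "w = u @ 1 # v" "1 \<notin> set u"
    by (metis split_list_first)
  have "length u \<in> insert 0 (descents w)"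
  proof (cases "u = []")
    case False
    then have "u ! (length u - 1) \<in> set u"
      by simp
    then have "u ! (length u - 1) \<noteq> 1" "u ! (length u - 1) \<in> {1..n}"
      using w set by auto
    then show ?thesis
      using False w by (auto simp: descents_def nth_append)
  qed simp
  then have "w ! 0 \<le> w ! length u"
    using assms(3) flattened_iff[OF ne] by blast
  moreover have "w ! length u = 1"
    using w by simp
  moreover have "w ! 0 \<in> {1..n}"
    using ne set nth_mem[of 0 w] by blast
  ultimately show ?thesis
    using ne by (simp add: hd_conv_nth)
qed

lemma flattened_if_hd_1:
  assumes "w \<in> stirling_perms n" "w \<noteq> []" "hd w = 1" "card (descents w) \<le> 1"
  shows "flattened w"
  unfolding flattened_iff[OF assms(2)]
proof (intro ballI impI)
  fix i i' assume *: "i \<in> insert 0 (descents w)" "i' \<in> insert 0 (descents w)" "i \<le> i'"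
  have "i' < length w"
    using * assms(2) by (auto simp: descents_def)
  then have "1 \<le> w ! i'"
    using set_stirling_perm[OF assms(1)] nth_mem[of i' w] by auto
  moreover have "i = 0 \<or> i = i'"
  proof (rule ccontr)
    assume "\<not> ?thesis"
    then have "i \<in> descents w" "i' \<in> descents w" "i \<noteq> i'"
      using * by auto
    then show False
      using assms(4) card_le_Suc0_iff_eq[OF finite_descents] by auto
  qed
  ultimately show "w ! i \<le> w ! i'"
    using assms(2,3) by (auto simp: hd_conv_nth)
qed

lemma flat_eq_one_headed:
  assumes "n \<ge> 1" "d \<le> 1"
  shows "flat (Suc d) (stirling_perms n) = one_headed n d"
proof -
  have ne: "w \<noteq> []" if "w \<in> stirling_perms n" for w
    using that assms(1) by (auto simp: stirling_perms_def)
  show ?thesis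
    using assms hd_flattened flattened_if_hd_1 ne
    by (auto simp: flat_def one_headed_def card_runs)
qed

section \<open>Insertion of the two greatest letters\<close>

definition insert_pair :: "nat \<Rightarrow> nat \<Rightarrow> nat list \<Rightarrow> nat list" where
  "insert_pair N k w = take k w @ [N, N] @ drop k w"

lemma nth_insert_pair:
  assumes "k \<le> length w"
  shows "insert_pair N k w ! j =
    (if j < k then w ! j else if j < k + 2 then N else w ! (j - 2))"
proof (cases "j < k + 2")
  case True
  then show ?thesis
    using assms by (auto simp: insert_pair_def nth_append nth_Cons')
next
  case False
  then have "insert_pair N k w ! j = drop k w ! (j - (k + 2))"
    using assms by (simp add: insert_pair_def nth_append)
  also have "\<dots> = w ! (k + (j - (k + 2)))"
    using assms by (rule nth_drop)
  finally show ?thesis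
    using False by simp
qed

lemma length_insert_pair [simp]: "length (insert_pair N k w) = length w + 2"
  by (simp add: insert_pair_def)

lemma count_list_insert_pair:
  "count_list (insert_pair N k w) i = count_list w i + (if i = N then 2 else 0)"
proof -
  have "count_list w i = count_list (take k w) i + count_list (drop k w) i"
    by (metis append_take_drop_id count_list_append)
  then show ?thesis
    by (simp add: insert_pair_def)
qed

lemma set_insert_pair: "set (insert_pair N k w) = insert N (set w)"
proof -
  have "set w = set (take k w) \<union> set (drop k w)"
    by (metis append_take_drop_id set_append)
  then show ?thesis
    by (auto simp: insert_pair_def)
qed

text \<open>The condition on the letters between two equal ones is separated from the counting of letters,
  so that it can be carried over to the shorter word and back by a shift of positions alone.\<close>

definition nested :: "nat list \<Rightarrow> bool" where
  "nested w \<longleftrightarrow> (\<forall>a b c. a < b \<and> b < c \<and> c < length w \<and> w ! a = w ! c \<longrightarrow> w ! a < w ! b)"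

lemma nested_insert_pair_iff:
  assumes k: "k \<le> length w" and less: "\<And>x. x \<in> set w \<Longrightarrow> x < N"
  shows "nested (insert_pair N k w) \<longleftrightarrow> nested w"
proof
  assume *: "nested (insert_pair N k w)"
  show "nested w"
    unfolding nested_def
  proof (intro allI impI)
    fix a b c assume abc: "a < b \<and> b < c \<and> c < length w \<and> w ! a = w ! c"
    \<comment> \<open>\<open>f\<close> sends a position in \<open>w\<close> to the position of the same letter after the insertion.\<close>
    define f where "f j = (if j < k then j else j + 2)" for j
    have f: "insert_pair N k w ! f j = w ! j" for j
      by (simp add: f_def nth_insert_pair[OF k])
    have "f a < f b" "f b < f c" "f c < length w + 2"
      using abc by (auto simp: f_def)
    then show "w ! a < w ! b"
      using * abc f unfolding nested_def by (metis length_insert_pair)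
  qed
next
  assume *: "nested w"
  show "nested (insert_pair N k w)"
    unfolding nested_def
  proof (intro allI impI)
    fix a b c
    assume abc: "a < b \<and> b < c \<and> c < length (insert_pair N k w) \<and>
      insert_pair N k w ! a = insert_pair N k w ! c"
    define g where "g j = (if j < k then j else j - 2)" for j
    define new where "new j \<longleftrightarrow> k \<le> j \<and> j < k + 2" for j
    have nth: "insert_pair N k w ! j = (if new j then N else w ! g j)" for j
      by (simp add: g_def new_def nth_insert_pair[OF k])
    have lt: "w ! g j < N" if "j < length w + 2" "\<not> new j" for j
      using that less nth_mem[of "g j" w] k by (auto simp: g_def new_def split: if_splits)
    \<comment> \<open>Equal letters at \<open>a\<close> and \<open>c\<close> are both new or both old, and the new ones are adjacent.\<close>
    have old: "\<not> new a" "\<not> new c"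
      using abc nth[of a] nth[of c] lt[of a] lt[of c] by (auto simp: new_def split: if_splits)
    show "insert_pair N k w ! a < insert_pair N k w ! b"
    proof (cases "new b")
      case True
      then show ?thesis
        using nth[of a] nth[of b] old lt[of a] abc by simp
    next
      case False
      have "g a < g b" "g b < g c" "g c < length w"
        using abc old False k by (auto simp: g_def new_def)
      moreover have "w ! g a = w ! g c"
        using abc nth[of a] nth[of c] old by simp
      ultimately have "w ! g a < w ! g b"
        using * unfolding nested_def by blast
      then show ?thesis
        using nth[of a] nth[of b] old False by simp
    qed
  qed
qed

lemma stirling_perms_alt:
  "w \<in> stirling_perms n \<longleftrightarrow> length w = 2 * n \<and> set w \<subseteq> {1..n} \<and>
     (\<forall>i\<in>{1..n}. count_list w i = 2) \<and> nested w"
  by (simp add: stirling_perms_def nested_def)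

lemma insert_pair_in_stirling_perms:
  assumes "w \<in> stirling_perms n" "k \<le> 2 * n"
  shows "insert_pair (Suc n) k w \<in> stirling_perms (Suc n)"
proof -
  have len: "length w = 2 * n" and set: "set w \<subseteq> {1..n}"
    and count: "\<forall>i\<in>{1..n}. count_list w i = 2" and nested: "nested w"
    using assms(1) by (auto simp: stirling_perms_alt)
  have less: "x < Suc n" if "x \<in> set w" for x
    using that set by auto
  have "count_list w (Suc n) = 0"
    using set by (auto simp: count_list_0_iff)
  then have "count_list (insert_pair (Suc n) k w) i = 2" if "i \<in> {1..Suc n}" for i
    using that count by (cases "i = Suc n") (auto simp: count_list_insert_pair)
  then show ?thesis
    using len set nested nested_insert_pair_iff[of k w "Suc n"] less assms(2)
    by (auto simp: stirling_perms_alt set_insert_pair)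
qed

text \<open>A letter between the two copies of the greatest letter would have to be greater still, so these
  copies form an adjacent pair that can be removed.\<close>

lemma stirling_perm_Suc_obtain:
  assumes "w \<in> stirling_perms (Suc n)"
  obtains w' k where "w' \<in> stirling_perms n" "k \<le> 2 * n" "w = insert_pair (Suc n) k w'"
proof -
  let ?N = "Suc n"
  have len: "length w = 2 * ?N" and set: "set w \<subseteq> {1..?N}"
    and count: "\<forall>i\<in>{1..?N}. count_list w i = 2" and nested: "nested w"
    using assms by (auto simp: stirling_perms_alt)
  have cN: "count_list w ?N = 2"
    using count by auto
  then have "?N \<in> set w"
    by (metis count_list_0_iff zero_neq_numeral)
  then obtain u x where w: "w = u @ ?N # x" "?N \<notin> set u"
    by (metis split_list_first)
  then have cx: "count_list x ?N = 1"
    using cN by (simp add: count_list_0_iff)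
  then have "?N \<in> set x"
    by (metis count_list_0_iff zero_neq_one)
  then obtain y v where x: "x = y @ ?N # v" "?N \<notin> set y"
    by (metis split_list_first)
  have "y = []"
  proof (rule ccontr)
    assume "y \<noteq> []"
    let ?a = "length u" and ?c = "Suc (length u + length y)"
    have "w ! ?a = ?N" "w ! ?c = ?N" "?c < length w" "?a < Suc ?a" "Suc ?a < ?c"
      using w x \<open>y \<noteq> []\<close> by (auto simp: nth_append)
    then have "?N < w ! Suc ?a" "w ! Suc ?a \<in> set w"
      using nested unfolding nested_def by (metis, simp)
    then show False
      using set by auto
  qed
  then have ins: "w = insert_pair ?N (length u) (u @ v)"
    using w x by (simp add: insert_pair_def)
  have "?N \<notin> set v"
    using cx x \<open>y = []\<close> by (simp add: count_list_0_iff)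
  then have set': "set (u @ v) \<subseteq> {1..n}"
    using set w x by (auto simp: le_Suc_eq)
  have len': "length (u @ v) = 2 * n"
    using len w x \<open>y = []\<close> by simp
  have "count_list (u @ v) i = 2" if "i \<in> {1..n}" for i
    using that count count_list_insert_pair[of ?N "length u" "u @ v" i] ins by auto
  moreover have "nested (u @ v)"
    using nested set' unfolding ins by (subst (asm) nested_insert_pair_iff) force+
  ultimately have "u @ v \<in> stirling_perms n"
    using len' set' by (simp add: stirling_perms_alt)
  moreover have "length u \<le> 2 * n"
    using len' by simp
  ultimately show thesis
    using ins that by blast
qed

lemma insert_pair_inject:
  assumes "N \<notin> set w" "N \<notin> set w'" "k \<le> length w" "k' \<le> length w'"
    and "insert_pair N k w = insert_pair N k' w'"
  shows "k = k' \<and> w = w'"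
proof -
  \<comment> \<open>The inserted block is found again at the first occurrence of \<open>N\<close>.\<close>
  have recover: "takeWhile (\<lambda>x. x \<noteq> N) (insert_pair N i u) = take i u \<and>
      dropWhile (\<lambda>x. x \<noteq> N) (insert_pair N i u) = N # N # drop i u" if "N \<notin> set u" for i u
  proof -
    have "\<forall>x\<in>set (take i u). x \<noteq> N"
      using that by (auto dest: in_set_takeD)
    then show ?thesis
      by (simp add: insert_pair_def)
  qed
  have eqs: "take k w = take k' w'" "drop k w = drop k' w'"
    using recover[OF assms(1), of k] recover[OF assms(2), of k'] assms(5) by auto
  have "k = length (take k w)" "k' = length (take k' w')"
    using assms(3,4) by auto
  then have "k = k'"
    using eqs(1) by metis
  moreover have "w = w'"
    using eqs by (metis append_take_drop_id)
  ultimately show ?thesis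
    by simp
qed

lemma bij_betw_insert_pair:
  "bij_betw (\<lambda>(w, k). insert_pair (Suc n) k w)
     (stirling_perms n \<times> {..2 * n}) (stirling_perms (Suc n))"
proof (rule bij_betw_imageI)
  show "inj_on (\<lambda>(w, k). insert_pair (Suc n) k w) (stirling_perms n \<times> {..2 * n})"
  proof (rule inj_onI)
    fix p q
    assume pq: "p \<in> stirling_perms n \<times> {..2 * n}" "q \<in> stirling_perms n \<times> {..2 * n}"
      "(case p of (w, k) \<Rightarrow> insert_pair (Suc n) k w) = (case q of (w, k) \<Rightarrow> insert_pair (Suc n) k w)"
    obtain w k w' k' where [simp]: "p = (w, k)" "q = (w', k')"
      by fastforce
    have "Suc n \<notin> set w" "Suc n \<notin> set w'" "k \<le> length w" "k' \<le> length w'"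
      using pq by (auto simp: stirling_perms_alt)
    then show "p = q"
      using pq(3) insert_pair_inject[of "Suc n" w w' k k'] by simp
  qed
  show "(\<lambda>(w, k). insert_pair (Suc n) k w) ` (stirling_perms n \<times> {..2 * n}) = stirling_perms (Suc n)"
    by (force intro: insert_pair_in_stirling_perms elim: stirling_perm_Suc_obtain)
qed

section \<open>The recurrence by descents\<close>

text \<open>The block is entered by an ascent and, unless it ends the word, left by a descent. If its gap
  was itself a descent, this only replaces the old descent by the new one.\<close>

lemma card_descents_insert_pair:
  assumes "0 < k" "k \<le> length w" and less: "\<And>x. x \<in> set w \<Longrightarrow> x < N"
  shows "card (descents (insert_pair N k w)) =
    card (descents w) + of_bool (k \<noteq> length w \<and> k \<notin> descents w)"
proof -
  let ?u = "take k w" and ?v = "drop k w"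
  have "?u \<noteq> []"
    using assms(1,2) by auto
  then have lu: "last ?u < N" "last ?u = w ! (k - 1)"
    using less[of "last ?u"] last_in_set[of ?u] in_set_takeD[of "last ?u" k w] assms(1,2)
    by (auto simp: last_conv_nth)
  have hv: "hd ?v < N \<and> hd ?v = w ! k" if "k < length w"
    using that less[of "w ! k"] by (simp add: hd_drop_conv_nth)
  have NN: "descents [N, N] = {}"
    by (auto simp: descents_def nth_Cons')
  have "card (descents (insert_pair N k w)) =
      card (descents ?u) + card (descents ?v) + of_bool (k < length w)"
    unfolding insert_pair_def
    using lu hv by (simp only: card_descents_append[of ?u] card_descents_append[of "[N, N]"] NN) auto
  moreover have "card (descents w) =
      card (descents ?u) + card (descents ?v) + of_bool (k < length w \<and> k \<in> descents w)"
    using card_descents_append[of ?u ?v] \<open>?u \<noteq> []\<close> lu hv assms(1)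
    by (auto simp: descents_def)
  ultimately show ?thesis
    using assms(2) by auto
qed

lemma hd_insert_pair:
  assumes "w \<noteq> []" "N \<noteq> x"
  shows "hd (insert_pair N k w) = x \<longleftrightarrow> 0 < k \<and> hd w = x"
  using assms by (cases k; cases w) (auto simp: insert_pair_def)

text \<open>The words are grouped by the word that remains after removal of their two greatest letters. The gap
  0 is left out of the sum because an insertion there would displace the leading 1.\<close>

lemma card_one_headed_sum:
  assumes "n \<ge> 1"
  shows "card (one_headed (Suc n) d) =
    (\<Sum>w | w \<in> stirling_perms n \<and> hd w = 1.
       card {k \<in> {1..2 * n}. card (descents w) + of_bool (k \<noteq> 2 * n \<and> k \<notin> descents w) = d})"
proof -
  let ?W = "{w \<in> stirling_perms n. hd w = 1}"
  let ?K = "\<lambda>w. {k \<in> {1..2 * n}. card (descents w) + of_bool (k \<noteq> 2 * n \<and> k \<notin> descents w) = d}"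
  let ?ins = "\<lambda>(w, k). insert_pair (Suc n) k w"
  have iff: "?ins (w, k) \<in> one_headed (Suc n) d \<longleftrightarrow> hd w = 1 \<and> k \<in> ?K w"
    if "w \<in> stirling_perms n" "k \<le> 2 * n" for w k
  proof -
    have w: "length w = 2 * n" "w \<noteq> []" "\<And>x. x \<in> set w \<Longrightarrow> x < Suc n"
      using that assms by (auto simp: stirling_perms_alt)
    have "hd (?ins (w, k)) = 1 \<longleftrightarrow> 0 < k \<and> hd w = 1"
      using w assms by (simp add: hd_insert_pair)
    then show ?thesis
      using that insert_pair_in_stirling_perms[OF that] card_descents_insert_pair[of k w "Suc n"] w
      by (auto simp: one_headed_def)
  qed
  have sub: "Sigma ?W ?K \<subseteq> stirling_perms n \<times> {..2 * n}"
    by auto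
  have img: "?ins ` Sigma ?W ?K = one_headed (Suc n) d"
  proof (intro equalityI subsetI)
    fix x assume "x \<in> ?ins ` Sigma ?W ?K"
    then show "x \<in> one_headed (Suc n) d"
      using iff by force
  next
    fix x assume x: "x \<in> one_headed (Suc n) d"
    then have "x \<in> ?ins ` (stirling_perms n \<times> {..2 * n})"
      unfolding bij_betw_imp_surj_on[OF bij_betw_insert_pair] by (simp add: one_headed_def)
    then obtain w k where "w \<in> stirling_perms n" "k \<le> 2 * n" "x = ?ins (w, k)"
      by blast
    then show "x \<in> ?ins ` Sigma ?W ?K"
      using iff x by blast
  qed
  have "inj_on ?ins (Sigma ?W ?K)"
    using inj_on_subset[OF bij_betw_imp_inj_on[OF bij_betw_insert_pair] sub] .
  from card_image[OF this] have "card (one_headed (Suc n) d) = card (Sigma ?W ?K)"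
    unfolding img .
  also have "\<dots> = (\<Sum>w\<in>?W. card (?K w))"
    by (rule card_SigmaI) (use finite_stirling_perms in auto)
  finally show ?thesis .
qed

text \<open>A gap is neutral if the insertion there keeps the number of descents. The right end is one more
  neutral gap besides the descents, since no letter follows it and so it is not a descent.\<close>

lemma card_neutral_gaps:
  assumes "length w = 2 * n" "n \<ge> 1"
  shows "card {k \<in> {1..2 * n}. k = 2 * n \<or> k \<in> descents w} = Suc (card (descents w))"
proof -
  have "{k \<in> {1..2 * n}. k = 2 * n \<or> k \<in> descents w} = insert (2 * n) (descents w)"
    using assms by (auto simp: descents_def)
  moreover have "2 * n \<notin> descents w"
    using assms by (simp add: descents_def)
  ultimately show ?thesis
    by simp
qed

lemma card_raising_gaps:
  assumes "length w = 2 * n" "n \<ge> 1"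
  shows "card {k \<in> {1..2 * n}. \<not> (k = 2 * n \<or> k \<in> descents w)} = 2 * n - Suc (card (descents w))"
proof -
  let ?S = "{k \<in> {1..2 * n}. k = 2 * n \<or> k \<in> descents w}"
  have "{k \<in> {1..2 * n}. \<not> (k = 2 * n \<or> k \<in> descents w)} = {1..2 * n} - ?S"
    by auto
  moreover have "card ({1..2 * n} - ?S) = card {1..2 * n} - card ?S"
    by (rule card_Diff_subset) auto
  ultimately show ?thesis
    using card_neutral_gaps[OF assms] by simp
qed

lemma card_one_headed_0:
  assumes "n \<ge> 1"
  shows "card (one_headed (Suc n) 0) = card (one_headed n 0)"
proof -
  let ?W = "{w \<in> stirling_perms n. hd w = 1}"
  have "card {k \<in> {1..2 * n}. card (descents w) + of_bool (k \<noteq> 2 * n \<and> k \<notin> descents w) = 0} =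
      (if card (descents w) = 0 then 1 else 0)" if "w \<in> ?W" for w
  proof -
    have "length w = 2 * n"
      using that by (simp add: stirling_perms_alt)
    from card_neutral_gaps[OF this assms] show ?thesis
      by (auto simp: disj_commute)
  qed
  then have "card (one_headed (Suc n) 0) = (\<Sum>w\<in>?W. if card (descents w) = 0 then 1 else 0)"
    unfolding card_one_headed_sum[OF assms] by (intro sum.cong) auto
  also have "\<dots> = card {w \<in> ?W. card (descents w) = 0}"
    using finite_stirling_perms by (simp add: sum.If_cases Int_def)
  also have "{w \<in> ?W. card (descents w) = 0} = one_headed n 0"
    by (auto simp: one_headed_def)
  finally show ?thesis .
qed

lemma card_one_headed_Suc:
  assumes "n \<ge> 1"
  shows "card (one_headed (Suc n) (Suc d)) =
    (d + 2) * card (one_headed n (Suc d)) + (2 * n - Suc d) * card (one_headed n d)"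
proof -
  let ?W = "{w \<in> stirling_perms n. hd w = 1}"
  have "card {k \<in> {1..2 * n}. card (descents w) + of_bool (k \<noteq> 2 * n \<and> k \<notin> descents w) = Suc d} =
      (if card (descents w) = Suc d then d + 2 else 0) +
      (if card (descents w) = d then 2 * n - Suc d else 0)" (is "card ?K = _")
    if "w \<in> ?W" for w
  proof -
    have len: "length w = 2 * n"
      using that by (simp add: stirling_perms_alt)
    consider "card (descents w) = Suc d" | "card (descents w) = d"
      | "card (descents w) \<noteq> Suc d" "card (descents w) \<noteq> d"
      by blast
    then show ?thesis
    proof cases
      case 1
      then have "?K = {k \<in> {1..2 * n}. k = 2 * n \<or> k \<in> descents w}"
        by auto
      then show ?thesis
        using 1 card_neutral_gaps[OF len assms] by simp
    next
      case 2
      then have "?K = {k \<in> {1..2 * n}. \<not> (k = 2 * n \<or> k \<in> descents w)}"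
        by auto
      then show ?thesis
        using 2 card_raising_gaps[OF len assms] by simp
    next
      case 3
      then have "?K = {}"
        by (auto simp: of_bool_def)
      then show ?thesis
        using 3 by simp
    qed
  qed
  then have "card (one_headed (Suc n) (Suc d)) =
      (\<Sum>w\<in>?W. if card (descents w) = Suc d then d + 2 else 0) +
      (\<Sum>w\<in>?W. if card (descents w) = d then 2 * n - Suc d else 0)"
    unfolding card_one_headed_sum[OF assms] sum.distrib[symmetric] by (intro sum.cong) auto
  moreover have "(\<Sum>w\<in>?W. if card (descents w) = e then c else 0) = c * card (one_headed n e)"
    for e c :: nat
  proof -
    have "?W \<inter> {w. card (descents w) = e} = one_headed n e"
      by (auto simp: one_headed_def)
    then show ?thesis
      using finite_stirling_perms by (simp add: sum.If_cases)
  qed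
  ultimately show ?thesis
    by simp
qed

lemma stirling_perms_1: "stirling_perms 1 = {[1, 1]}"
proof (intro equalityI subsetI)
  fix w assume "w \<in> stirling_perms 1"
  then have "length w = 2" "set w \<subseteq> {1}"
    by (auto simp: stirling_perms_alt)
  then show "w \<in> {[1, 1]}"
    by (auto simp: numeral_2_eq_2 length_Suc_conv)
next
  fix w :: "nat list" assume "w \<in> {[1, 1]}"
  then show "w \<in> stirling_perms 1"
    by (auto simp: stirling_perms_def)
qed

lemma one_headed_1: "one_headed 1 d = (if d = 0 then {[1, 1]} else {})"
proof -
  have "descents [1, 1] = {}"
    by (auto simp: descents_def nth_Cons')
  then show ?thesis
    unfolding one_headed_def stirling_perms_1 by auto
qed

lemma card_one_headed_no_descent:
  assumes "n \<ge> 1"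
  shows "card (one_headed n 0) = 1"
  using assms
proof (induction n rule: dec_induct)
  case base
  show ?case
    using one_headed_1[of 0] by simp
next
  case (step n)
  then show ?case
    by (simp add: card_one_headed_0)
qed

theorem proposition4p4:
  fixes n :: nat
  assumes "n \<ge> 1"
  shows "card (flat 1 (stirling_perms n)) = 1 \<and>
         card (flat 2 (stirling_perms (n + 1))) = 2 * card (flat 2 (stirling_perms n)) + 2 * n - 1 \<and>
         card (flat 2 (stirling_perms 1)) = 0"
proof -
  have flat1: "flat 1 (stirling_perms n) = one_headed n 0"
    using flat_eq_one_headed[of n 0] assms by simp
  have flat2: "flat 2 (stirling_perms m) = one_headed m 1" if "m \<ge> 1" for m
    using flat_eq_one_headed[of m 1] that by (simp add: numeral_2_eq_2)
  have "card (one_headed (Suc n) 1) = 2 * card (one_headed n 1) + (2 * n - 1)"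
    using card_one_headed_Suc[OF assms, of 0] card_one_headed_no_descent[OF assms] by simp
  then show ?thesis
    using assms card_one_headed_no_descent[OF assms] one_headed_1[of 1] flat2[of 1]
    unfolding flat1 by (simp add: flat2)
qed

end
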